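(* Let $(a_n)_{n \in \mathbb{N}}$ be a sequence of distinct positive integers, and for $N \geq 1$ let $A_N = \{a_1, \ldots, a_N\}$. If $E(A_N) = \Omega(N^3)$, then for every real number $\alpha$ the sequence $(\{a_n \alpha\})_{n \in \mathbb{N}}$ does not have Poissonian pair correlations.
   Context: For a finite set $A$ of reals, the additive energy is $E(A) = \#\{(a,b,c,d) \in A^4 : a+b = c+d\}$. The notation $E(A_N) = \Omega(N^3)$ means that there is a constant $\kappa > 0$ with $E(A_N) \geq \kappa N^3$ for infinitely many $N$ (i.e. $\limsup_{N\to\infty} E(A_N)/N^3 > 0$). $\{x\}$ denotes the fractional part of $x$ and $\|x\|$ the distance from $x$ to the nearest integer. A sequence $(x_n)_{n\in\mathbb{N}}$ in $[0,1)$ has (asymptotically) Poissonian pair correlations if for every $s > 0$, $$R_2([-s,s],(x_n),N) := \frac{1}{N}\#\left\{1 \leq i \neq j \leq N : \|x_i - x_j\| \leq \frac{s}{N}\right\} \to 2s \quad (N \to \infty).$$ *)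

theory Defs
  imports Complex_Main
begin

definition additive_energy :: "real set \<Rightarrow> nat" where
  "additive_energy A = card {(a,b,c,d). a \<in> A \<and> b \<in> A \<and> c \<in> A \<and> d \<in> A \<and> a + b = c + d}"

definition dist_nint :: "real \<Rightarrow> real" where
  "dist_nint x = \<bar>x - round x\<bar>"

definition R2 :: "real \<Rightarrow> (nat \<Rightarrow> real) \<Rightarrow> nat \<Rightarrow> real" where
  "R2 s x N = (1 / real N) *
     real (card {(i,j). i \<in> {1..N} \<and> j \<in> {1..N} \<and> i \<noteq> j \<and> dist_nint (x i - x j) \<le> s / real N})"

definition poissonian_pair_correlations :: "(nat \<Rightarrow> real) \<Rightarrow> bool" where
  "poissonian_pair_correlations x \<longleftrightarrow> (\<forall>s>0. (\<lambda>N. R2 s x N) \<longlonglongrightarrow> 2 * s)"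

end

theory Submission
  imports Defs "HOL-Analysis.Convex"
begin

text \<open>
  Write \<open>r(e)\<close> for the number of pairs of \<open>A = A\<^sub>N\<close> with difference \<open>e\<close>. The energy is
  \<open>\<Sum>m. \<bar>A \<inter> (A + m)\<bar>\<^sup>2\<close>, and by pigeonhole on the circle a proportion of at least \<open>1/K\<close> of the pairs
  in each \<open>A \<inter> (A + m)\<close> has a difference \<open>e\<close> with \<open>\<parallel>e \<alpha>\<parallel> \<le> 1/K\<close>. Counting the surviving
  quadruples by that difference instead of by \<open>m\<close> gives \<open>E(A) \<le> K \<Sum>e. r(e)\<^sup>2\<close>, the sum running over
  \<open>\<parallel>e \<alpha>\<parallel> \<le> 1/K\<close>. Take \<open>K\<close> about \<open>N/S\<close> with \<open>S\<close> a large constant: the term \<open>e = 0\<close> is then too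
  small to account for the energy, and \<open>\<Sum>e. r(e) = O(N)\<close> over the remaining \<open>e\<close> by Poissonian pair
  correlations, so some \<open>e \<noteq> 0\<close> with \<open>\<parallel>e \<alpha>\<parallel> \<le> S/N\<close> has \<open>r(e) \<ge> \<eta> N\<close>. Hence the pair correlation
  function, as a function of \<open>s \<le> S\<close>, jumps by at least \<open>\<eta>\<close> for infinitely many \<open>N\<close>. Being monotone
  in \<open>s\<close>, it cannot converge pointwise to the continuous function \<open>2 s\<close>.
\<close>

section \<open>Differences within a finite set of integers\<close>

text \<open>Via \<open>p \<mapsto> (p, p - m)\<close> this set encodes the pairs of \<open>A\<close>
  with difference \<open>m\<close>; its cardinality is the \<open>r(m)\<close> of the
  overview.\<close>

definition shift_inter :: "int set \<Rightarrow> int \<Rightarrow> int set" where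
  "shift_inter A m = {p \<in> A. p - m \<in> A}"

definition difference_set :: "int set \<Rightarrow> int set" where
  "difference_set A = (\<lambda>(p, q). p - q) ` (A \<times> A)"

text \<open>The diagonal is left out as in \<open>R2\<close>; pairs of elements replace pairs of
  indices, and \<open>\<delta>\<close> stands for \<open>s / N\<close>.\<close>

definition close_pairs :: "int set \<Rightarrow> real \<Rightarrow> real \<Rightarrow> (int \<times> int) set" where
  "close_pairs A \<alpha> \<delta> =
     {(p, q). p \<in> A \<and> q \<in> A \<and> p \<noteq> q \<and> dist_nint (of_int (p - q) * \<alpha>) \<le> \<delta>}"

lemma finite_shift_inter: "finite A \<Longrightarrow> finite (shift_inter A m)"
  by (simp add: shift_inter_def)

lemma finite_difference_set: "finite A \<Longrightarrow> finite (difference_set A)"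
  by (simp add: difference_set_def)

lemma difference_setI: "p \<in> A \<Longrightarrow> q \<in> A \<Longrightarrow> p - q \<in> difference_set A"
  by (force simp: difference_set_def)

lemma finite_close_pairs: "finite A \<Longrightarrow> finite (close_pairs A \<alpha> \<delta>)"
  by (rule finite_subset[of _ "A \<times> A"]) (auto simp: close_pairs_def)

section \<open>Distance to the nearest integer\<close>

lemma dist_nint_le: "dist_nint x \<le> \<bar>x - of_int k\<bar>"
  unfolding dist_nint_def using round_diff_minimal[of x k] by (simp add: abs_minus_commute)

lemma dist_nint_nonneg: "dist_nint x \<ge> 0"
  by (simp add: dist_nint_def)

lemma dist_nint_diff_of_int: "dist_nint (x - of_int k) = dist_nint x"
proof (rule antisym)
  show "dist_nint (x - of_int k) \<le> dist_nint x"
    using dist_nint_le[of "x - of_int k" "round x - k"] by (simp add: dist_nint_def)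
  show "dist_nint x \<le> dist_nint (x - of_int k)"
    using dist_nint_le[of x "round (x - of_int k) + k"] by (simp add: dist_nint_def algebra_simps)
qed

lemma dist_nint_frac_diff: "dist_nint (frac x - frac y) = dist_nint (x - y)"
proof -
  have "frac x - frac y = (x - y) - of_int (\<lfloor>x\<rfloor> - \<lfloor>y\<rfloor>)"
    by (simp add: frac_def)
  then show ?thesis
    by (simp only: dist_nint_diff_of_int)
qed

section \<open>Pigeonhole on the circle\<close>

lemma sum_card_fibres_square:
  fixes f :: "'a \<Rightarrow> 'b"
  assumes "finite P"
  shows "card {(p, q). p \<in> P \<and> q \<in> P \<and> f p = f q} = (\<Sum>c\<in>f ` P. (card {p \<in> P. f p = c})\<^sup>2)"
proof -
  have "{(p, q). p \<in> P \<and> q \<in> P \<and> f p = f q} = (\<Union>c\<in>f ` P. {p \<in> P. f p = c} \<times> {p \<in> P. f p = c})"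
    by auto
  also have "card \<dots> = (\<Sum>c\<in>f ` P. card ({p \<in> P. f p = c} \<times> {p \<in> P. f p = c}))"
    using assms by (intro card_UN_disjoint) auto
  finally show ?thesis
    by (simp add: card_cartesian_product power2_eq_square)
qed

text \<open>Cauchy-Schwarz for the fibre sizes, which add up to \<open>card P\<close> and are at
  most \<open>card C\<close> in number.\<close>

lemma card_square_le_card_fibre_pairs:
  fixes f :: "'a \<Rightarrow> 'b"
  assumes "finite P" "finite C" "f ` P \<subseteq> C"
  shows "(card P)\<^sup>2 \<le> card C * card {(p, q). p \<in> P \<and> q \<in> P \<and> f p = f q}"
proof -
  have "real (card P) = (\<Sum>c\<in>f ` P. real (card {p \<in> P. f p = c}))"
    using sum.image_gen[OF assms(1), of "\<lambda>_. 1::real" f] by simp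
  then have "(real (card P))\<^sup>2 \<le> (\<Sum>c\<in>f ` P. (real (card {p \<in> P. f p = c}))\<^sup>2) * real (card (f ` P))"
    using Cauchy_Schwarz_ineq_sum[of "\<lambda>c. real (card {p \<in> P. f p = c})" "\<lambda>_. 1" "f ` P"] by simp
  also have "\<dots> = real (card {(p, q). p \<in> P \<and> q \<in> P \<and> f p = f q}) * real (card (f ` P))"
    by (simp add: sum_card_fibres_square[OF assms(1)])
  also have "\<dots> \<le> real (card {(p, q). p \<in> P \<and> q \<in> P \<and> f p = f q}) * real (card C)"
    using card_mono[OF assms(2,3)] by (intro mult_left_mono) auto
  finally have "real ((card P)\<^sup>2) \<le> real (card C * card {(p, q). p \<in> P \<and> q \<in> P \<and> f p = f q})"
    by (simp add: mult.commute)
  then show ?thesis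
    by (simp only: of_nat_le_iff)
qed

text \<open>Cut the circle into \<open>K\<close> arcs of length \<open>1 / K\<close>: two points in
  one arc are near, and the preceding inequality bounds the pairs sharing an arc from below.\<close>

lemma card_square_le_near_pairs:
  fixes P :: "int set" and K :: nat
  assumes "finite P" "K > 0"
  shows "(card P)\<^sup>2 \<le>
    K * card {(p, q). p \<in> P \<and> q \<in> P \<and> dist_nint (of_int (p - q) * \<alpha>) \<le> 1 / real K}"
proof -
  define g where "g = (\<lambda>p::int. \<lfloor>real K * frac (of_int p * \<alpha>)\<rfloor>)"
  have cells: "g ` P \<subseteq> {0..<int K}"
    using assms(2) by (auto simp: g_def floor_less_iff frac_lt_1)
  have near: "dist_nint (of_int (p - q) * \<alpha>) \<le> 1 / real K" if "g p = g q" for p q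
  proof -
    let ?x = "frac (of_int p * \<alpha>)" and ?y = "frac (of_int q * \<alpha>)"
    have "\<bar>real K * ?x - real K * ?y\<bar> \<le> 1"
      using that unfolding g_def by linarith
    then have "real K * \<bar>?x - ?y\<bar> \<le> 1"
      using assms(2) by (simp flip: right_diff_distrib add: abs_mult)
    then have "\<bar>?x - ?y\<bar> \<le> 1 / real K"
      using assms(2) by (simp add: field_simps)
    moreover have "dist_nint (of_int (p - q) * \<alpha>) = dist_nint (?x - ?y)"
      by (simp add: dist_nint_frac_diff left_diff_distrib)
    ultimately show ?thesis
      using dist_nint_le[of "?x - ?y" 0] by simp
  qed
  have "(card P)\<^sup>2 \<le> K * card {(p, q). p \<in> P \<and> q \<in> P \<and> g p = g q}"
    using card_square_le_card_fibre_pairs[OF assms(1) _ cells] by simp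
  also have "\<dots> \<le>
      K * card {(p, q). p \<in> P \<and> q \<in> P \<and> dist_nint (of_int (p - q) * \<alpha>) \<le> 1 / real K}"
  proof (intro mult_left_mono card_mono)
    show "finite {(p, q). p \<in> P \<and> q \<in> P \<and> dist_nint (of_int (p - q) * \<alpha>) \<le> 1 / real K}"
      by (rule finite_subset[of _ "P \<times> P"]) (use assms(1) in auto)
  qed (use near in blast, simp)
  finally show ?thesis .
qed

section \<open>Additive energy counted by differences\<close>

lemma additive_energy_eq_sum_shift_inter:
  assumes "finite A"
  shows "additive_energy (real_of_int ` A) = (\<Sum>m\<in>difference_set A. (card (shift_inter A m))\<^sup>2)"
proof -
  have "additive_energy (real_of_int ` A) =
      card (SIGMA m:difference_set A. shift_inter A m \<times> shift_inter A m)"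
    unfolding additive_energy_def
  \<comment> \<open>A solution of \<open>a + b = c + d\<close> is coded by
    \<open>m = a - d = c - b\<close>, \<open>p = a\<close>, \<open>q = c\<close>; the floors turn
    real entries back into integers.\<close>
  proof (rule sym, rule bij_betw_same_card[where f = "\<lambda>(m, p, q).
        (real_of_int p, real_of_int (q - m), real_of_int q, real_of_int (p - m))"],
      rule bij_betw_byWitness[where f' = "\<lambda>(a, b, c, d). (\<lfloor>a - d\<rfloor>, \<lfloor>a\<rfloor>, \<lfloor>c\<rfloor>)"], goal_cases)
    case 1
    then show ?case
      by auto
  next
    case 2
    have fl: "\<lfloor>real_of_int a - real_of_int d\<rfloor> = a - d" for a d
      by (metis floor_of_int of_int_diff)
    have "real_of_int a + real_of_int b = real_of_int c + real_of_int d \<longleftrightarrow> a + b = c + d" for a b c d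
      by (metis of_int_add of_int_eq_iff)
    then show ?case
      by (auto simp: fl)
  next
    case 3
    then show ?case
      by (auto simp: shift_inter_def simp flip: of_int_diff)
  next
    case 4
    have fl: "\<lfloor>real_of_int a - real_of_int d\<rfloor> = a - d" for a d
      by (metis floor_of_int of_int_diff)
    have "real_of_int a + real_of_int b = real_of_int c + real_of_int d \<longleftrightarrow> b = c - (a - d)"
      for a b c d
      by (smt (verit) of_int_add of_int_eq_iff)
    then show ?case
      by (auto simp: fl shift_inter_def intro: difference_setI)
  qed
  also have "\<dots> = (\<Sum>m\<in>difference_set A. (card (shift_inter A m))\<^sup>2)"
    using assms by (simp add: finite_difference_set finite_shift_inter card_cartesian_product power2_eq_square)
  finally show ?thesis .
qed

text \<open>Both sides count parallelograms \<open>p, q, p - m, q - m\<close> in \<open>A\<close>.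
  The involution \<open>(m, p, q) \<mapsto> (p - q, p, p - m)\<close> exchanges their two side
  vectors \<open>m\<close> and \<open>p - q\<close>.\<close>

lemma sum_near_pairs_shift_inter:
  assumes "finite A"
  shows "(\<Sum>m\<in>difference_set A. card {(p, q). p \<in> shift_inter A m \<and> q \<in> shift_inter A m \<and> R (p - q)}) =
    (\<Sum>e\<in>{e \<in> difference_set A. R e}. (card (shift_inter A e))\<^sup>2)"
proof -
  let ?X = "\<lambda>m. {(p, q). p \<in> shift_inter A m \<and> q \<in> shift_inter A m \<and> R (p - q)}"
  have fin: "finite (?X m)" for m
    by (rule finite_subset[of _ "A \<times> A"]) (use assms in \<open>auto simp: shift_inter_def\<close>)
  have "(\<Sum>m\<in>difference_set A. card (?X m)) = card (SIGMA m:difference_set A. ?X m)"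
    using assms fin by (simp add: finite_difference_set)
  also have "\<dots> = card (SIGMA e:{e \<in> difference_set A. R e}. shift_inter A e \<times> shift_inter A e)"
    by (rule bij_betw_same_card[where f = "\<lambda>(m, p, q). (p - q, p, p - m)"],
        rule bij_betw_byWitness[where f' = "\<lambda>(m, p, q). (p - q, p, p - m)"])
       (auto simp: shift_inter_def intro: difference_setI)
  also have "\<dots> = (\<Sum>e\<in>{e \<in> difference_set A. R e}. (card (shift_inter A e))\<^sup>2)"
    using assms by (simp add: finite_difference_set finite_shift_inter card_cartesian_product power2_eq_square)
  finally show ?thesis .
qed

lemma sum_card_shift_inter_eq_close_pairs:
  assumes "finite A"
  shows "(\<Sum>e\<in>{e \<in> difference_set A. e \<noteq> 0 \<and> dist_nint (of_int e * \<alpha>) \<le> \<delta>}. card (shift_inter A e)) =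
    card (close_pairs A \<alpha> \<delta>)"
proof -
  let ?D = "{e \<in> difference_set A. e \<noteq> 0 \<and> dist_nint (of_int e * \<alpha>) \<le> \<delta>}"
  have "(\<Sum>e\<in>?D. card (shift_inter A e)) = card (SIGMA e:?D. shift_inter A e)"
    using assms by (simp add: finite_difference_set finite_shift_inter)
  also have "\<dots> = card (close_pairs A \<alpha> \<delta>)"
    by (rule bij_betw_same_card[where f = "\<lambda>(e, p). (p, p - e)"],
        rule bij_betw_byWitness[where f' = "\<lambda>(p, q). (p - q, p)"])
       (auto simp: shift_inter_def close_pairs_def intro: difference_setI)
  finally show ?thesis .
qed

text \<open>Pigeonhole in each \<open>shift_inter A m\<close> and the exchange of side vectors leave
  \<open>K\<close> times the sum of \<open>r(e)\<close> squared over near \<open>e\<close>. The term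
  \<open>e = 0\<close> gives \<open>card A\<close> squared; elsewhere one factor \<open>r(e)\<close>
  is at most \<open>M\<close> and the other sums to the number of close pairs.\<close>

lemma additive_energy_le:
  fixes A :: "int set" and K :: nat and M :: real
  assumes "finite A" "K > 0"
    and M: "\<And>e. e \<noteq> 0 \<Longrightarrow> dist_nint (of_int e * \<alpha>) \<le> 1 / real K \<Longrightarrow> real (card (shift_inter A e)) \<le> M"
  shows "real (additive_energy (real_of_int ` A)) \<le>
    real K * ((real (card A))\<^sup>2 + M * real (card (close_pairs A \<alpha> (1 / real K))))"
proof -
  let ?R = "\<lambda>e::int. dist_nint (of_int e * \<alpha>) \<le> 1 / real K"
  let ?D = "{e \<in> difference_set A. e \<noteq> 0 \<and> ?R e}"
  have "additive_energy (real_of_int ` A) \<le> (\<Sum>m\<in>difference_set A.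
      K * card {(p, q). p \<in> shift_inter A m \<and> q \<in> shift_inter A m \<and> ?R (p - q)})"
    unfolding additive_energy_eq_sum_shift_inter[OF assms(1)]
    by (intro sum_mono card_square_le_near_pairs finite_shift_inter assms)
  also have "\<dots> = K * (\<Sum>e\<in>{e \<in> difference_set A. ?R e}. (card (shift_inter A e))\<^sup>2)"
    using sum_near_pairs_shift_inter[OF assms(1), of ?R] by (simp only: sum_distrib_left[symmetric])
  \<comment> \<open>Inserting \<open>0\<close> spares a case split: it is missing from the
    differences only if \<open>A\<close> is empty.\<close>
  also have "\<dots> \<le> K * (\<Sum>e\<in>insert 0 ?D. (card (shift_inter A e))\<^sup>2)"
    using assms(1) by (intro mult_left_mono sum_mono2) (auto simp: finite_difference_set)
  also have "\<dots> = K * ((card A)\<^sup>2 + (\<Sum>e\<in>?D. (card (shift_inter A e))\<^sup>2))"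
    using assms(1) by (simp add: finite_difference_set shift_inter_def)
  finally have "real (additive_energy (real_of_int ` A)) \<le>
      real (K * ((card A)\<^sup>2 + (\<Sum>e\<in>?D. (card (shift_inter A e))\<^sup>2)))"
    by (simp only: of_nat_le_iff)
  also have "\<dots> = real K * ((real (card A))\<^sup>2 +
      (\<Sum>e\<in>?D. real (card (shift_inter A e)) * real (card (shift_inter A e))))"
    by (simp add: power2_eq_square)
  also have "\<dots> \<le> real K * ((real (card A))\<^sup>2 + (\<Sum>e\<in>?D. M * real (card (shift_inter A e))))"
    by (intro mult_left_mono add_left_mono sum_mono mult_right_mono) (auto intro: M)
  also have "(\<Sum>e\<in>?D. M * real (card (shift_inter A e))) =
      M * real (card (close_pairs A \<alpha> (1 / real K)))"
    by (simp flip: sum_card_shift_inter_eq_close_pairs[OF assms(1)] add: sum_distrib_left)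
  finally show ?thesis .
qed

section \<open>Jumps of the pair correlation function\<close>

lemma card_close_pairs_jump:
  assumes "finite A" "e \<noteq> 0" "\<delta>\<^sub>1 < dist_nint (of_int e * \<alpha>)" "dist_nint (of_int e * \<alpha>) \<le> \<delta>\<^sub>2"
  shows "card (shift_inter A e) + card (close_pairs A \<alpha> \<delta>\<^sub>1) \<le> card (close_pairs A \<alpha> \<delta>\<^sub>2)"
proof -
  let ?J = "(\<lambda>p. (p, p - e)) ` shift_inter A e"
  have "card (shift_inter A e) + card (close_pairs A \<alpha> \<delta>\<^sub>1) = card ?J + card (close_pairs A \<alpha> \<delta>\<^sub>1)"
    by (simp add: card_image inj_on_def)
  also have "\<dots> = card (?J \<union> close_pairs A \<alpha> \<delta>\<^sub>1)"
    using assms by (intro card_Un_disjoint[symmetric] finite_imageI finite_shift_inter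
      finite_close_pairs) (auto simp: close_pairs_def)
  also have "\<dots> \<le> card (close_pairs A \<alpha> \<delta>\<^sub>2)"
    using assms by (intro card_mono finite_close_pairs) (auto simp: close_pairs_def shift_inter_def)
  finally show ?thesis .
qed

text \<open>Injectivity of \<open>a\<close> matches index pairs with element pairs, and fractional
  parts change differences by integers only.\<close>

lemma R2_frac_eq_card_close_pairs:
  assumes "inj_on a {1..N}"
  shows "R2 s (\<lambda>n. frac (real_of_int (a n) * \<alpha>)) N =
    real (card (close_pairs (a ` {1..N}) \<alpha> (s / real N))) / real N"
proof -
  let ?S = "{(i, j). i \<in> {1..N} \<and> j \<in> {1..N} \<and> i \<noteq> j \<and>
    dist_nint (frac (real_of_int (a i) * \<alpha>) - frac (real_of_int (a j) * \<alpha>)) \<le> s / real N}"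
  have inj: "inj_on (map_prod a a) ?S"
    by (rule inj_on_subset[OF map_prod_inj_on[OF assms assms]]) blast
  have "map_prod a a ` ?S = close_pairs (a ` {1..N}) \<alpha> (s / real N)"
  proof
    show "map_prod a a ` ?S \<subseteq> close_pairs (a ` {1..N}) \<alpha> (s / real N)"
      using inj_on_eq_iff[OF assms]
      by (auto simp: close_pairs_def dist_nint_frac_diff left_diff_distrib)
    show "close_pairs (a ` {1..N}) \<alpha> (s / real N) \<subseteq> map_prod a a ` ?S"
    proof
      fix z assume "z \<in> close_pairs (a ` {1..N}) \<alpha> (s / real N)"
      then obtain i j where "z = (a i, a j)" "i \<in> {1..N}" "j \<in> {1..N}" "a i \<noteq> a j"
          "dist_nint (of_int (a i - a j) * \<alpha>) \<le> s / real N"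
        unfolding close_pairs_def by blast
      then have "z = map_prod a a (i, j)" "(i, j) \<in> ?S"
        by (auto simp: dist_nint_frac_diff left_diff_distrib)
      then show "z \<in> map_prod a a ` ?S"
        by (rule image_eqI)
    qed
  qed
  with card_image[OF inj] have "card ?S = card (close_pairs (a ` {1..N}) \<alpha> (s / real N))"
    by (simp only:)
  then show ?thesis
    by (simp add: R2_def)
qed

text \<open>If every near difference were unpopular, the energy would be at most
  \<open>K * (N^2 + N^2 / 2)\<close> with \<open>K\<close> about \<open>N / S\<close>. The choice
  \<open>S = 4 / \<kappa>\<close> makes this at most \<open>3 / 4\<close> of the assumed lower
  bound.\<close>

lemma ex_popular_close_difference:
  fixes A :: "int set" and \<kappa> S C :: real
  assumes "finite A" "card A = N" "N > 0" "\<kappa> > 0" "C > 0"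
    and S: "S = 4 / \<kappa>" "S \<le> real N"
    and energy: "\<kappa> * real N ^ 3 \<le> real (additive_energy (real_of_int ` A))"
    and pairs: "real (card (close_pairs A \<alpha> (S / real N))) \<le> C * real N"
  shows "\<exists>e. e \<noteq> 0 \<and> dist_nint (of_int e * \<alpha>) \<le> S / real N \<and>
    real N / (2 * C) < real (card (shift_inter A e))"
proof (rule ccontr)
  assume "\<not> ?thesis"
  then have unpopular: "real (card (shift_inter A e)) \<le> real N / (2 * C)"
    if "e \<noteq> 0" "dist_nint (of_int e * \<alpha>) \<le> S / real N" for e
    using that by force
  have "S > 0"
    using S assms by simp
  define K where "K = nat \<lceil>real N / S\<rceil>"
  have K1: "real N / S \<le> real K" and K2: "real K \<le> real N / S + 1"
    using \<open>S > 0\<close> by (auto simp: K_def of_nat_ceiling)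
  have "0 < real N / S"
    using \<open>S > 0\<close> assms by simp
  then have "K > 0"
    using K1 by (metis of_nat_0_less_iff order_less_le_trans)
  have KS: "1 / real K \<le> S / real N"
    using K1 \<open>S > 0\<close> \<open>K > 0\<close> \<open>N > 0\<close> by (simp add: field_simps)
  \<comment> \<open>This absorbs the rounding in \<open>K\<close>, giving
    \<open>K \<le> 2 * N / S = \<kappa> / 2 * N\<close>.\<close>
  have "1 \<le> real N / S"
    using S(2) \<open>S > 0\<close> by simp
  then have K3: "real K \<le> \<kappa> / 2 * real N"
    using K2 S(1) \<open>\<kappa> > 0\<close> by (simp add: field_simps)
  have "card (close_pairs A \<alpha> (1 / real K)) \<le> card (close_pairs A \<alpha> (S / real N))"
    using KS by (intro card_mono finite_close_pairs assms) (auto simp: close_pairs_def)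
  then have close: "real (card (close_pairs A \<alpha> (1 / real K))) \<le> C * real N"
    using pairs by linarith
  have "\<kappa> * real N ^ 3 \<le>
      real K * ((real N)\<^sup>2 + real N / (2 * C) * real (card (close_pairs A \<alpha> (1 / real K))))"
    using energy additive_energy_le[OF assms(1) \<open>K > 0\<close>, of \<alpha> "real N / (2 * C)"] unpopular KS assms(2)
    by fastforce
  also have "\<dots> \<le> \<kappa> / 2 * real N * ((real N)\<^sup>2 + real N / (2 * C) * (C * real N))"
    using K3 close assms by (intro mult_mono add_left_mono mult_left_mono) auto
  also have "\<dots> = 3 / 4 * (\<kappa> * real N ^ 3)"
    using \<open>C > 0\<close> by (simp add: field_simps power2_eq_square power3_eq_cube)
  finally show False
    using \<open>\<kappa> > 0\<close> \<open>N > 0\<close> by simp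
qed

section \<open>Contradiction with the continuous limit\<close>

theorem theorem1:
  fixes a :: "nat \<Rightarrow> int"
  assumes pos: "\<And>n. n \<ge> 1 \<Longrightarrow> a n > 0"
    and distinct: "inj_on a {1..}"
    and energy: "\<exists>\<kappa>>0. \<exists>\<^sub>F N in sequentially.
        real (additive_energy ((\<lambda>n. real_of_int (a n)) ` {1..N})) \<ge> \<kappa> * real N ^ 3"
  shows "\<forall>\<alpha>::real. \<not> poissonian_pair_correlations (\<lambda>n. frac (real_of_int (a n) * \<alpha>))"
proof (intro allI notI)
  fix \<alpha> :: real
  let ?x = "\<lambda>n. frac (real_of_int (a n) * \<alpha>)"
  assume "poissonian_pair_correlations ?x"
  then have lim: "(\<lambda>N. R2 s ?x N) \<longlonglongrightarrow> 2 * s" if "s > 0" for s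
    using that by (simp add: poissonian_pair_correlations_def)
  obtain \<kappa> where "\<kappa> > 0" and freq: "\<exists>\<^sub>F N in sequentially.
      \<kappa> * real N ^ 3 \<le> real (additive_energy ((\<lambda>n. real_of_int (a n)) ` {1..N}))"
    using energy by blast
  define S where "S = 4 / \<kappa>"
  define C where "C = 2 * S + 1"
  \<comment> \<open>A popular difference forces a jump above
    \<open>1 / (2 * C) = 6 * \<epsilon>\<close>. Between grid points \<open>2 * \<epsilon>\<close>
    apart the limit rises by \<open>4 * \<epsilon>\<close>, and the two errors add less than
    \<open>2 * \<epsilon>\<close>.\<close>
  define \<epsilon> where "\<epsilon> = 1 / (12 * C)"
  define L where "L = nat \<lceil>S / \<epsilon>\<rceil> + 1"
  have "S > 0" "C > 0" "\<epsilon> > 0"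
    using \<open>\<kappa> > 0\<close> by (auto simp: S_def C_def \<epsilon>_def add_pos_pos)
  have evS: "\<forall>\<^sub>F N in sequentially. R2 S ?x N < C"
    using order_tendstoD(2)[OF lim[OF \<open>S > 0\<close>], of C] by (simp add: C_def)
  \<comment> \<open>The jump location depends on \<open>N\<close>, so closeness to the limit is
    needed at all grid points simultaneously; finiteness of the grid provides it.\<close>
  have grid: "\<forall>\<^sub>F N in sequentially. \<forall>k\<in>{1..L}. \<bar>R2 (real k * \<epsilon>) ?x N - 2 * (real k * \<epsilon>)\<bar> < \<epsilon>"
  proof (intro eventually_ball_finite ballI)
    fix k assume "k \<in> {1..L}"
    then have "real k * \<epsilon> > 0"
      using \<open>\<epsilon> > 0\<close> by simp
    from tendstoD[OF lim[OF this] \<open>\<epsilon> > 0\<close>]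
    show "\<forall>\<^sub>F N in sequentially. \<bar>R2 (real k * \<epsilon>) ?x N - 2 * (real k * \<epsilon>)\<bar> < \<epsilon>"
      by (simp add: dist_real_def)
  qed simp
  have "\<forall>\<^sub>F N in sequentially. N > nat \<lceil>S\<rceil>"
    by (rule eventually_gt_at_top)
  from frequently_eventually_conj[OF freq eventually_conj[OF this eventually_conj[OF evS grid]]]
  obtain N where E: "\<kappa> * real N ^ 3 \<le> real (additive_energy ((\<lambda>n. real_of_int (a n)) ` {1..N}))"
    and N: "N > nat \<lceil>S\<rceil>" and RS: "R2 S ?x N < C"
    and R: "\<And>k. k \<in> {1..L} \<Longrightarrow> \<bar>R2 (real k * \<epsilon>) ?x N - 2 * (real k * \<epsilon>)\<bar> < \<epsilon>"
    by (auto dest!: frequently_ex)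
  define A where "A = a ` {1..N}"
  have inj: "inj_on a {1..N}"
    by (rule inj_on_subset[OF distinct]) auto
  have A: "finite A" "card A = N" and "N > 0" and SN: "S \<le> real N"
    using N card_image[OF inj] by (simp_all add: A_def) linarith
  have R2: "R2 s ?x N = real (card (close_pairs A \<alpha> (s / real N))) / real N" for s
    unfolding A_def by (rule R2_frac_eq_card_close_pairs[OF inj])
  have "\<kappa> * real N ^ 3 \<le> real (additive_energy (real_of_int ` A))"
    using E by (simp add: A_def image_image)
  moreover have "real (card (close_pairs A \<alpha> (S / real N))) \<le> C * real N"
    using RS[unfolded R2] \<open>N > 0\<close> by (simp add: field_simps)
  ultimately obtain e where e: "e \<noteq> 0" "dist_nint (of_int e * \<alpha>) \<le> S / real N"
      "real N / (2 * C) < real (card (shift_inter A e))"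
    using ex_popular_close_difference[OF A \<open>N > 0\<close> \<open>\<kappa> > 0\<close> \<open>C > 0\<close> S_def SN] by blast
  define t where "t = real N * dist_nint (of_int e * \<alpha>)"
  have t: "0 \<le> t" "t \<le> S"
    using e(2) \<open>N > 0\<close> by (auto simp: t_def dist_nint_nonneg field_simps)
  define k where "k = nat \<lfloor>t / \<epsilon>\<rfloor>"
  have k: "real k \<le> t / \<epsilon>" "t / \<epsilon> < real k + 1"
    using t(1) \<open>\<epsilon> > 0\<close> by (auto simp: k_def of_nat_nat)
  have "t / \<epsilon> \<le> S / \<epsilon>"
    using t(2) \<open>\<epsilon> > 0\<close> by (simp add: divide_right_mono)
  then have "real k \<le> real_of_int \<lceil>S / \<epsilon>\<rceil>"
    using k(1) by linarith
  then have "k + 1 \<le> L"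
    unfolding L_def by linarith
  \<comment> \<open>The lower point uses \<open>k - 1\<close> because \<open>t\<close> may equal
    \<open>k * \<epsilon>\<close>, and pairs at distance exactly \<open>t\<close> must not yet be
    counted there.\<close>
  let ?s1 = "(real k - 1) * \<epsilon>" and ?s2 = "real (k + 1) * \<epsilon>"
  have s: "?s1 < t" "t \<le> ?s2"
    using k \<open>\<epsilon> > 0\<close> by (auto simp: field_simps)
  have "?s1 / real N < dist_nint (of_int e * \<alpha>)" "dist_nint (of_int e * \<alpha>) \<le> ?s2 / real N"
    using s \<open>N > 0\<close> by (simp_all add: t_def field_simps)
  from card_close_pairs_jump[OF A(1) e(1) this]
  have "real (card (shift_inter A e)) + real (card (close_pairs A \<alpha> (?s1 / real N)))
      \<le> real (card (close_pairs A \<alpha> (?s2 / real N)))"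
    by (metis of_nat_add of_nat_le_iff)
  then have "real (card (shift_inter A e)) / real N + R2 ?s1 ?x N \<le> R2 ?s2 ?x N"
    unfolding R2 using \<open>N > 0\<close> by (simp add: divide_right_mono flip: add_divide_distrib)
  moreover have "6 * \<epsilon> < real (card (shift_inter A e)) / real N"
    using e(3) \<open>N > 0\<close> \<open>C > 0\<close> by (simp add: \<epsilon>_def field_simps)
  moreover have "R2 ?s2 ?x N < 2 * ?s2 + \<epsilon>"
    using R[of "k + 1"] \<open>k + 1 \<le> L\<close> by auto
  \<comment> \<open>For \<open>k \<le> 1\<close> the lower point is not positive and lies off the
    grid, but then the left side is negative while \<open>R2\<close> is not.\<close>
  moreover have "2 * ?s1 - \<epsilon> < R2 ?s1 ?x N"
  proof (cases "k \<ge> 2")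
    case True
    then have "k - 1 \<in> {1..L}"
      using \<open>k + 1 \<le> L\<close> by auto
    from R[OF this] have "\<bar>R2 ?s1 ?x N - 2 * ?s1\<bar> < \<epsilon>"
      using True by (simp add: of_nat_diff)
    then show ?thesis
      by linarith
  next
    case False
    then have "?s1 \<le> 0"
      using \<open>\<epsilon> > 0\<close> by (intro mult_nonpos_nonneg) auto
    moreover have "0 \<le> R2 ?s1 ?x N"
      by (simp add: R2)
    ultimately show ?thesis
      using \<open>\<epsilon> > 0\<close> by linarith
  qed
  ultimately show False
    by (simp add: algebra_simps)
qed

end
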